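(* For each integer $n\ge 2$, let $\rho_n$ denote the number of conjugacy classes of involutions in the twin group $T_n$. Then for each $n\ge 2$, $\rho_n+1=\mathbf{F}_{n+1}$, where $(\mathbf{F}_m)_{m\ge 1}$ is the Fibonacci sequence with $\mathbf{F}_1=\mathbf{F}_2=1$. In particular, $$\rho_n=\sum_{k=1}^{\lfloor n/2\rfloor}\binom{n-k}{k}.$$
   Context: For an integer $n\ge 2$, the twin group $T_n$ is the group generated by $s_1,\dots,s_{n-1}$ with defining relations $s_i^2=1$ for all $i$, and $s_is_j=s_js_i$ whenever $|i-j|\ge 2$. An involution is an element of order $2$. *)

theory Defs
  imports "HOL-Algebra.Algebra" "HOL-Number_Theory.Fib"
begin

text \<open>Groups given by generators and relations. The letter \<open>(a, True)\<close> stands for the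
  generator \<open>a\<close> and \<open>(a, False)\<close> for its formal inverse; a pair \<open>(u, v)\<close> of words in \<open>R\<close>
  stands for the defining relation \<open>u = v\<close>.\<close>

type_synonym 'a gword = "('a \<times> bool) list"

definition gwords :: "'a set \<Rightarrow> 'a gword set" where
  "gwords S = lists (S \<times> UNIV)"

inductive pres_eq :: "'a set \<Rightarrow> ('a gword \<times> 'a gword) set \<Rightarrow> 'a gword \<Rightarrow> 'a gword \<Rightarrow> bool"
  for S R where
  refl: "u \<in> gwords S \<Longrightarrow> pres_eq S R u u"
| sym: "pres_eq S R u v \<Longrightarrow> pres_eq S R v u"
| trans: "pres_eq S R u v \<Longrightarrow> pres_eq S R v w \<Longrightarrow> pres_eq S R u w"
| append: "pres_eq S R u u' \<Longrightarrow> pres_eq S R v v' \<Longrightarrow> pres_eq S R (u @ v) (u' @ v')"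
| cancel: "a \<in> S \<Longrightarrow> pres_eq S R [(a, b), (a, \<not> b)] []"
| relator: "(u, v) \<in> R \<Longrightarrow> u \<in> gwords S \<Longrightarrow> v \<in> gwords S \<Longrightarrow> pres_eq S R u v"

definition presented_group :: "'a set \<Rightarrow> ('a gword \<times> 'a gword) set \<Rightarrow> 'a gword set monoid" where
  "presented_group S R =
    \<lparr> carrier = gwords S // {(u, v). pres_eq S R u v},
      monoid.mult = (\<lambda>A B. {w. \<exists>u\<in>A. \<exists>v\<in>B. pres_eq S R (u @ v) w}),
      one = {w. pres_eq S R [] w} \<rparr>"

definition twin_relations :: "nat \<Rightarrow> (nat gword \<times> nat gword) set" where
  "twin_relations n =
     {([(i, True), (i, True)], []) | i. i \<in> {1..<n}} \<union>
     {([(i, True), (j, True)], [(j, True), (i, True)]) | i j.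
        i \<in> {1..<n} \<and> j \<in> {1..<n} \<and> \<bar>int i - int j\<bar> \<ge> 2}"

definition twin_group :: "nat \<Rightarrow> nat gword set monoid" where
  "twin_group n = presented_group {1..<n} (twin_relations n)"

definition involutions :: "('a, 'b) monoid_scheme \<Rightarrow> 'a set" where
  "involutions G = {x \<in> carrier G. group.ord G x = 2}"

definition conjugacy_class :: "('a, 'b) monoid_scheme \<Rightarrow> 'a \<Rightarrow> 'a set" where
  "conjugacy_class G x = {g \<otimes>\<^bsub>G\<^esub> x \<otimes>\<^bsub>G\<^esub> inv\<^bsub>G\<^esub> g | g. g \<in> carrier G}"

text \<open>\<open>card\<close> of an infinite set is \<open>0\<close>; any positive value of \<open>rho n\<close> entails that there are
  finitely many classes.\<close>

definition rho :: "nat \<Rightarrow> nat" where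
  "rho n = card (conjugacy_class (twin_group n) ` involutions (twin_group n))"

lemma pres_eq_gwords:
  "pres_eq S R u v \<Longrightarrow> u \<in> gwords S \<and> v \<in> gwords S"
  by (induction rule: pres_eq.induct) (auto simp: gwords_def)

lemma equiv_pres_eq: "equiv (gwords S) {(u, v). pres_eq S R u v}"
  by (rule equivI)
     (auto simp: refl_on_def sym_def trans_def dest: pres_eq_gwords
           intro: pres_eq.refl pres_eq.sym pres_eq.trans)

lemma carrier_presented_group:
  "carrier (presented_group S R) = {{w. pres_eq S R u w} | u. u \<in> gwords S}"
  by (auto simp: presented_group_def quotient_def Image_def)

lemma mult_presented_group:
  assumes "u \<in> gwords S" "v \<in> gwords S"
  shows "{w. pres_eq S R u w} \<otimes>\<^bsub>presented_group S R\<^esub> {w. pres_eq S R v w} =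
         {w. pres_eq S R (u @ v) w}"
proof -
  have "pres_eq S R (u @ v) w \<longleftrightarrow>
        (\<exists>u'. pres_eq S R u u' \<and> (\<exists>v'. pres_eq S R v v' \<and> pres_eq S R (u' @ v') w))" for w
    using assms by (meson pres_eq.refl pres_eq.append pres_eq.trans)
  thus ?thesis by (auto simp: presented_group_def)
qed

lemma pres_eq_class_eq: "pres_eq S R u v \<Longrightarrow> {w. pres_eq S R u w} = {w. pres_eq S R v w}"
  by (auto intro: pres_eq.trans pres_eq.sym)

lemma pres_eq_inverse:
  assumes "u \<in> gwords S"
  shows "\<exists>v\<in>gwords S. pres_eq S R (v @ u) []"
  using assms
proof (induction u)
  case Nil
  show ?case by (auto simp: gwords_def intro!: pres_eq.refl bexI[of _ "[]"])
next
  case (Cons x u)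
  obtain a b where x: "x = (a, b)" by (cases x)
  from Cons.prems have a: "a \<in> S" and u: "u \<in> gwords S" by (auto simp: gwords_def x)
  from Cons.IH[OF u] obtain v where v: "v \<in> gwords S" "pres_eq S R (v @ u) []" by blast
  have "pres_eq S R ([(a, \<not> b), (a, b)] @ u) ([] @ u)"
    using pres_eq.cancel[OF a, of R "\<not> b"] u by (intro pres_eq.append pres_eq.refl) auto
  hence "pres_eq S R (v @ [(a, \<not> b), (a, b)] @ u) (v @ u)"
    using v(1) by (intro pres_eq.append[OF pres_eq.refl]) auto
  hence "pres_eq S R ((v @ [(a, \<not> b)]) @ x # u) []"
    using v(2) by (auto simp: x intro: pres_eq.trans)
  moreover have "v @ [(a, \<not> b)] \<in> gwords S"
    using v(1) a by (auto simp: gwords_def)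
  ultimately show ?case by blast
qed

lemma group_presented_group: "group (presented_group S R)"
proof -
  let ?G = "presented_group S R"
  let ?c = "\<lambda>u. {w. pres_eq S R u w}"
  have car: "carrier ?G = ?c ` gwords S"
    by (auto simp: carrier_presented_group)
  have one: "\<one>\<^bsub>?G\<^esub> = ?c []" by (simp add: presented_group_def)
  have nil: "[] \<in> gwords S" and app: "\<And>u v. u \<in> gwords S \<Longrightarrow> v \<in> gwords S \<Longrightarrow> u @ v \<in> gwords S"
    by (auto simp: gwords_def)
  show ?thesis
  proof (rule groupI)
    fix x assume "x \<in> carrier ?G"
    then obtain u where u: "u \<in> gwords S" "x = ?c u" by (auto simp: car)
    obtain v where v: "v \<in> gwords S" "pres_eq S R (v @ u) []"
      using pres_eq_inverse[OF u(1)] by blast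
    have "?c v \<otimes>\<^bsub>?G\<^esub> x = \<one>\<^bsub>?G\<^esub>"
      using u v pres_eq_class_eq[OF v(2)] by (simp add: mult_presented_group one)
    thus "\<exists>y\<in>carrier ?G. y \<otimes>\<^bsub>?G\<^esub> x = \<one>\<^bsub>?G\<^esub>"
      using v(1) by (auto simp: car)
  qed (use nil app in \<open>auto simp: car one mult_presented_group\<close>)
qed

corollary group_twin_group: "group (twin_group n)"
  by (simp add: twin_group_def group_presented_group)

end

theory Submission
  imports Defs
begin

text \<open>Conjugacy classes of involutions correspond to the nonempty sets of pairwise non-adjacent
  generators. A word representing \<open>1\<close> contains a factor \<open>s x s\<close> in which every letter of
  \<open>x\<close> commutes with \<open>s\<close>. Apply this to \<open>w w\<close> for an involution \<open>w\<close>: either \<open>w\<close> or a conjugate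
  of it can be shortened, or both ends of the factor are the same letter of \<open>w\<close>, which then
  commutes with the rest of \<open>w\<close> and can be split off. Hence \<open>w\<close> is conjugate to a product of
  distinct commuting generators. The parities of the letters are conjugacy invariants, so
  different sets give different classes; subsets of \<open>{1..<n}\<close> without two consecutive elements
  are counted by \<open>fib (n + 1)\<close>.\<close>

section \<open>Words in the generators and the group elements they represent\<close>

text \<open>\<open>\<not> adjacent i j\<close> covers \<open>i = j\<close> as well as distance at
  least two, so it serves as a single commutation condition for generators.\<close>

definition adjacent :: "nat \<Rightarrow> nat \<Rightarrow> bool" where
  "adjacent i j \<longleftrightarrow> i = Suc j \<or> j = Suc i"

lemma adjacent_irrefl [simp]: "\<not> adjacent i i"
  by (simp add: adjacent_def)

lemma adjacent_commute: "adjacent i j \<longleftrightarrow> adjacent j i"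
  by (auto simp: adjacent_def)

text \<open>Generators are their own inverses, so plain index lists reach every group element
  (\<open>twin_group_elt_cases\<close>) and the signs of letters can be forgotten.\<close>

definition twin_elt :: "nat \<Rightarrow> nat list \<Rightarrow> nat gword set" where
  "twin_elt n w =
     {v. pres_eq {1..<n} (twin_relations n) (map (\<lambda>i. (i, True)) w) v}"

lemma positive_word_in_gwords:
  "set w \<subseteq> {1..<n} \<Longrightarrow> map (\<lambda>i. (i, True)) w \<in> gwords {1..<n}"
  by (auto simp: gwords_def)

lemma twin_elt_carrier [simp]:
  "set w \<subseteq> {1..<n} \<Longrightarrow> twin_elt n w \<in> carrier (twin_group n)"
  unfolding twin_group_def carrier_presented_group twin_elt_def
  using positive_word_in_gwords by blast

lemma twin_elt_Nil: "twin_elt n [] = \<one>\<^bsub>twin_group n\<^esub>"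
  by (simp add: twin_elt_def twin_group_def presented_group_def)

lemma twin_elt_append:
  assumes "set u \<subseteq> {1..<n}" "set v \<subseteq> {1..<n}"
  shows "twin_elt n (u @ v) = twin_elt n u \<otimes>\<^bsub>twin_group n\<^esub> twin_elt n v"
  using mult_presented_group[OF positive_word_in_gwords[OF assms(1)]
      positive_word_in_gwords[OF assms(2)], of "twin_relations n"]
  by (simp add: twin_elt_def twin_group_def)

lemma twin_elt_Cons:
  assumes "i \<in> {1..<n}" "set v \<subseteq> {1..<n}"
  shows "twin_elt n (i # v) = twin_elt n [i] \<otimes>\<^bsub>twin_group n\<^esub> twin_elt n v"
  using twin_elt_append[of "[i]" n v] assms by simp

lemma twin_elt_square:
  assumes "i \<in> {1..<n}"
  shows "twin_elt n [i] \<otimes>\<^bsub>twin_group n\<^esub> twin_elt n [i] = \<one>\<^bsub>twin_group n\<^esub>"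
proof -
  have "pres_eq {1..<n} (twin_relations n) [(i, True), (i, True)] []"
    using assms by (intro pres_eq.relator) (auto simp: twin_relations_def gwords_def)
  hence "twin_elt n [i, i] = twin_elt n []"
    unfolding twin_elt_def by (simp add: pres_eq_class_eq)
  thus ?thesis using assms by (simp add: twin_elt_Cons[of i n "[i]"] twin_elt_Nil)
qed

lemma twin_elt_swap:
  assumes "i \<in> {1..<n}" "j \<in> {1..<n}" "\<not> adjacent i j"
  shows "twin_elt n [i] \<otimes>\<^bsub>twin_group n\<^esub> twin_elt n [j] =
         twin_elt n [j] \<otimes>\<^bsub>twin_group n\<^esub> twin_elt n [i]"
proof (cases "i = j")
  case False
  hence far: "\<bar>int i - int j\<bar> \<ge> 2"
    using assms(3) unfolding adjacent_def by linarith
  have "pres_eq {1..<n} (twin_relations n) [(i, True), (j, True)] [(j, True), (i, True)]"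
    using assms far by (intro pres_eq.relator) (auto simp: twin_relations_def gwords_def)
  hence "twin_elt n [i, j] = twin_elt n [j, i]"
    unfolding twin_elt_def by (simp add: pres_eq_class_eq)
  thus ?thesis
    using assms by (simp add: twin_elt_Cons[of i n "[j]"] twin_elt_Cons[of j n "[i]"])
qed simp

lemma twin_elt_commute:
  assumes "s \<in> {1..<n}" "set x \<subseteq> {1..<n}" "\<forall>t\<in>set x. \<not> adjacent s t"
  shows "twin_elt n [s] \<otimes>\<^bsub>twin_group n\<^esub> twin_elt n x =
         twin_elt n x \<otimes>\<^bsub>twin_group n\<^esub> twin_elt n [s]"
  using assms(2,3)
proof (induction x)
  interpret group "twin_group n" by (rule group_twin_group)
  {
    case Nil
    show ?case using assms(1) by (simp add: twin_elt_Nil)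
  next
    case (Cons t x)
    then show ?case
      using assms(1) twin_elt_swap[of s n t]
      by (simp add: twin_elt_Cons[of t n x] m_assoc[symmetric]) (simp add: m_assoc)
  }
qed

lemma twin_elt_rev:
  assumes "set g \<subseteq> {1..<n}"
  shows "twin_elt n (rev g) = inv\<^bsub>twin_group n\<^esub> twin_elt n g"
  using assms
proof (induction g)
  interpret group "twin_group n" by (rule group_twin_group)
  {
    case Nil
    show ?case by (simp add: twin_elt_Nil)
  next
    case (Cons i g)
    have "inv\<^bsub>twin_group n\<^esub> twin_elt n [i] = twin_elt n [i]"
      using Cons.prems by (intro inv_equality twin_elt_square) auto
    then show ?case
      using Cons by (simp add: twin_elt_append twin_elt_Cons[of i n g] inv_mult_group)
  }
qed

lemma pres_eq_positive:
  assumes "u \<in> gwords {1..<n}"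
  shows "pres_eq {1..<n} (twin_relations n) u (map (\<lambda>i. (i, True)) (map fst u))"
  using assms
proof (induction u)
  case Nil
  show ?case by (auto simp: gwords_def intro: pres_eq.refl)
next
  case (Cons x u)
  let ?E = "pres_eq {1..<n} (twin_relations n)"
  obtain i b where x: "x = (i, b)" by (cases x)
  have i: "i \<in> {1..<n}" using Cons.prems by (auto simp: gwords_def x)
  have "?E [(i, False)] [(i, True)]"
  proof -
    have sq: "?E [(i, True), (i, True)] []"
      using i by (intro pres_eq.relator) (auto simp: twin_relations_def gwords_def)
    have "?E [(i, False)] [(i, False)]" "?E [(i, True)] [(i, True)]"
      using i by (auto intro!: pres_eq.refl simp: gwords_def)
    \<comment> \<open>With \<open>s\<close> the generator, the word \<open>s^-1 s s\<close> is
      evaluated in two ways: cancelling the square leaves \<open>s^-1\<close>, cancelling the first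
      two letters leaves \<open>s\<close>.\<close>
    then have "?E ([(i, False)] @ [(i, True), (i, True)]) ([(i, False)] @ [])"
      and "?E ([(i, False), (i, True)] @ [(i, True)]) ([] @ [(i, True)])"
      using sq pres_eq.cancel[OF i, of "twin_relations n" False] by (intro pres_eq.append; simp)+
    thus ?thesis by (auto intro: pres_eq.trans pres_eq.sym)
  qed
  moreover have "?E [(i, True)] [(i, True)]"
    using i by (auto intro!: pres_eq.refl simp: gwords_def)
  ultimately have "?E [x] [(i, True)]" by (cases b) (auto simp: x)
  moreover have "?E u (map (\<lambda>i. (i, True)) (map fst u))"
    using Cons by (auto simp: gwords_def)
  ultimately have "?E ([x] @ u) ([(i, True)] @ map (\<lambda>i. (i, True)) (map fst u))"
    by (rule pres_eq.append)
  thus ?case by (simp add: x)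
qed

lemma twin_group_elt_cases:
  assumes "x \<in> carrier (twin_group n)"
  obtains w where "set w \<subseteq> {1..<n}" "x = twin_elt n w"
proof -
  obtain u where u: "u \<in> gwords {1..<n}" "x = {v. pres_eq {1..<n} (twin_relations n) u v}"
    using assms by (auto simp: twin_group_def carrier_presented_group)
  have "x = twin_elt n (map fst u)"
    unfolding u(2) twin_elt_def by (intro pres_eq_class_eq pres_eq_positive u(1))
  moreover have "set (map fst u) \<subseteq> {1..<n}" using u(1) by (auto simp: gwords_def)
  ultimately show ?thesis by (rule that[rotated])
qed

section \<open>Actions of the twin group as invariants\<close>

lemma pres_eq_twin_action:
  assumes "pres_eq {1..<n} (twin_relations n) u v"
    and square: "\<And>i. f i \<circ> f i = id"
    and swap: "\<And>i j. \<not> adjacent i j \<Longrightarrow> f i \<circ> f j = f j \<circ> f i"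
  shows "foldr (f \<circ> fst) u = foldr (f \<circ> fst) v"
  using assms(1)
proof induction
  case (relator u v)
  then consider i where "u = [(i, True), (i, True)]" "v = []"
    | i j where "u = [(i, True), (j, True)]" "v = [(j, True), (i, True)]"
        "\<bar>int i - int j\<bar> \<ge> 2"
    unfolding twin_relations_def by blast
  then show ?case
  proof cases
    case 1
    then show ?thesis using square by simp
  next
    case 2
    then have "\<not> adjacent i j" by (auto simp: adjacent_def)
    then show ?thesis using 2 swap[of i j] by (simp add: fun_eq_iff)
  qed
qed (auto simp: square)

text \<open>Maps satisfying the defining relations give an action of the group, so words acting
  differently represent different elements. This is used below with a parity bit and with
  \<open>play\<close>.\<close>

lemma twin_elt_action:
  assumes "twin_elt n u = twin_elt n v" "set v \<subseteq> {1..<n}"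
    and square: "\<And>i. f i \<circ> f i = id"
    and swap: "\<And>i j. \<not> adjacent i j \<Longrightarrow> f i \<circ> f j = f j \<circ> f i"
  shows "foldr f u = foldr f v"
proof -
  have "map (\<lambda>i. (i, True)) v \<in> twin_elt n v"
    using positive_word_in_gwords[OF assms(2)] by (auto simp: twin_elt_def intro: pres_eq.refl)
  hence "pres_eq {1..<n} (twin_relations n) (map (\<lambda>i. (i, True)) u) (map (\<lambda>i. (i, True)) v)"
    by (simp add: assms(1)[symmetric]) (simp add: twin_elt_def)
  from pres_eq_twin_action[OF this, of f, OF square swap] show ?thesis
    by (simp add: fun_eq_iff foldr_map comp_def)
qed

lemma twin_elt_parity:
  assumes "twin_elt n u = twin_elt n v" "set v \<subseteq> {1..<n}"
  shows "odd (count_list u a) \<longleftrightarrow> odd (count_list v a)"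
proof -
  \<comment> \<open>The letter \<open>a\<close> flips a bit and all other letters fix it, so a word
    records the parity of its number of letters \<open>a\<close>.\<close>
  define f where "f i b = (if i = a then \<not> b else b)" for i and b :: bool
  have "foldr f u = foldr f v"
    using assms by (rule twin_elt_action) (auto simp: f_def fun_eq_iff)
  moreover have "foldr f w b \<longleftrightarrow> (odd (count_list w a) \<longleftrightarrow> \<not> b)" for w b
    by (induction w) (auto simp: f_def)
  ultimately show ?thesis by metis
qed

section \<open>Reduced words and the word problem\<close>

text \<open>The dual of the geometric representation of the right-angled Coxeter group \<open>T\<^sub>n\<close>
  (Mozes' numbers game). A letter that can be moved to the front of a reduced word is a left
  descent, and shows up as a negative coordinate of the image of the all-ones vector.\<close>

definition play :: "nat \<Rightarrow> (nat \<Rightarrow> int) \<Rightarrow> nat \<Rightarrow> int" where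
  "play s f t = (if t = s then - f s else if adjacent s t then f t + 2 * f s else f t)"

lemma play_play: "play s \<circ> play s = id"
  by (auto simp: play_def fun_eq_iff)

lemma play_commute: "\<not> adjacent s t \<Longrightarrow> play s \<circ> play t = play t \<circ> play s"
  by (auto simp: play_def fun_eq_iff adjacent_commute)

text \<open>A purely syntactic notion, defined for all words: the letters with an occurrence
  preceded only by letters not adjacent to it.\<close>

fun descents :: "nat list \<Rightarrow> nat set" where
  "descents [] = {}"
| "descents (s # w) = insert s {t \<in> descents w. \<not> adjacent s t}"

text \<open>Length in the group is not mentioned: a word is reduced if commutations cannot bring two
  equal letters together. Failure of the condition thus directly exhibits a cancelling
  factor.\<close>

fun reduced :: "nat list \<Rightarrow> bool" where
  "reduced [] \<longleftrightarrow> True"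
| "reduced (s # w) \<longleftrightarrow> s \<notin> descents w \<and> reduced w"

lemma descents_split:
  "s \<in> descents w \<Longrightarrow> \<exists>x q. w = x @ s # q \<and> (\<forall>t\<in>set x. \<not> adjacent s t)"
proof (induction w)
  case (Cons r w)
  show ?case
  proof (cases "s = r")
    case True
    then show ?thesis by (intro exI[of _ "[]"] exI[of _ w]) auto
  next
    case False
    with Cons obtain x q where "w = x @ s # q" "\<forall>t\<in>set x. \<not> adjacent s t" by auto
    moreover have "\<not> adjacent s r" using Cons.prems False by (auto simp: adjacent_commute)
    ultimately show ?thesis by (intro exI[of _ "r # x"] exI[of _ q]) auto
  qed
qed simp

lemma not_reduced_split:
  "\<not> reduced w \<Longrightarrow> \<exists>p s x q. w = p @ s # x @ s # q \<and> (\<forall>t\<in>set x. \<not> adjacent s t)"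
proof (induction w)
  case (Cons r w)
  show ?case
  proof (cases "reduced w")
    case True
    with Cons.prems have "r \<in> descents w" by simp
    from descents_split[OF this] show ?thesis by (metis append_Nil)
  next
    case False
    with Cons.IH show ?thesis by (metis append_Cons)
  qed
qed simp

text \<open>The third clause is what makes a descent \<open>t\<close> adjacent to \<open>s\<close> turn positive when
  \<open>s\<close> is played.\<close>

lemma reduced_play:
  assumes "reduced w"
  defines "f \<equiv> foldr play w (\<lambda>_. 1)"
  shows "(\<forall>t\<in>descents w. f t < 0) \<and> (\<forall>t. t \<notin> descents w \<longrightarrow> f t > 0) \<and>
         (\<forall>t\<in>descents w. \<forall>s. adjacent s t \<longrightarrow> f s + f t \<ge> 0)"
  using assms(1) unfolding f_def
proof (induction w)
  case (Cons s w)
  define f where "f = foldr play w (\<lambda>_. 1)"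
  have neg: "\<And>t. t \<in> descents w \<Longrightarrow> f t < 0"
    and pos: "\<And>t. t \<notin> descents w \<Longrightarrow> f t > 0"
    and dom: "\<And>s t. t \<in> descents w \<Longrightarrow> adjacent s t \<Longrightarrow> f s + f t \<ge> 0"
    using Cons by (auto simp: f_def)
  have s: "f s > 0" using Cons.prems pos by simp
  have near: "f t + f s \<ge> 0" if "adjacent s t" for t
    using dom[of t s] pos[of t] s that by (cases "t \<in> descents w") auto
  have "play s f t < 0" if "t \<in> descents (s # w)" for t
    using that neg[of t] s by (auto simp: play_def)
  moreover have "play s f t > 0" if "t \<notin> descents (s # w)" for t
    using that pos[of t] s near[of t] by (auto simp: play_def)
  \<comment> \<open>For \<open>t = s\<close> the new sum is \<open>f r + f s\<close>. Otherwise
    \<open>t\<close> is an old descent not adjacent to \<open>s\<close>, so \<open>f t\<close> is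
    unchanged, and \<open>f r\<close> can only grow since \<open>r\<close> differs from
    \<open>s\<close>.\<close>
  moreover have "play s f r + play s f t \<ge> 0"
    if "t \<in> descents (s # w)" "adjacent r t" for r t
    using that s near[of r] dom[of t r] by (auto simp: play_def adjacent_commute)
  ultimately show ?case by (simp add: f_def)
qed simp

text \<open>The first letter of a nonempty reduced word is a descent, so the word sends the all-ones
  vector to one with a negative coordinate, whereas the identity fixes that vector.\<close>

lemma reduced_trivial:
  assumes "twin_elt n w = \<one>\<^bsub>twin_group n\<^esub>" "reduced w"
  shows "w = []"
proof (cases w)
  case (Cons s v)
  have "foldr play w = foldr play []"
    by (rule twin_elt_action[of n]) (use assms(1) play_play play_commute in \<open>auto simp: twin_elt_Nil\<close>)
  moreover have "foldr play w (\<lambda>_. 1) s < 0"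
    using reduced_play[OF assms(2)] by (simp add: Cons)
  ultimately show ?thesis by simp
qed

section \<open>Conjugating involutions to products of commuting generators\<close>

definition nonadjacent :: "nat set \<Rightarrow> bool" where
  "nonadjacent A \<longleftrightarrow> (\<forall>i\<in>A. \<forall>j\<in>A. \<not> adjacent i j)"

text \<open>Products over a set are encoded by its sorted list; this allows a new commuting
  generator to enter at its sorted place.\<close>

lemma twin_elt_insort:
  assumes "s \<in> {1..<n}" "set x \<subseteq> {1..<n}" "\<forall>t\<in>set x. \<not> adjacent s t"
  shows "twin_elt n (insort s x) = twin_elt n [s] \<otimes>\<^bsub>twin_group n\<^esub> twin_elt n x"
  using assms(2,3)
proof (induction x)
  interpret group "twin_group n" by (rule group_twin_group)
  {
    case Nil
    show ?case using assms(1) by (simp add: twin_elt_Nil)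
  next
    case (Cons t x)
    then show ?case
      using assms(1) twin_elt_swap[of s n t]
      by (simp add: twin_elt_Cons[of s n "t # x"] twin_elt_Cons[of t n x]
          twin_elt_Cons[of t n "insort s x"] set_insort_key m_assoc[symmetric])
  }
qed

text \<open>The two marked letters \<open>s\<close> lie either in the same copy of \<open>w\<close>
  or in different copies. In the latter case \<open>x\<close> consists of the tail \<open>b\<close>
  of the first copy and the head \<open>c\<close> of the second.\<close>

lemma square_split:
  assumes "w @ w = p @ s # x @ s # q"
  obtains (inside) a d where "w = a @ s # x @ s # d"
  | (across) p' b c q' where "w = p' @ s # b" "w = c @ s # q'" "set b \<union> set c \<subseteq> set x"
proof -
  from assms consider us where "w = p @ us" "us @ w = s # x @ s # q"
    | us where "w = us @ s # x @ s # q"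
    by (auto simp: append_eq_append_conv2)
  then show ?thesis
  proof cases
    case 1
    show ?thesis
    proof (cases us)
      case Nil
      then show ?thesis using 1 inside[of "[]" q] by simp
    next
      case (Cons r us')
      with 1 have w: "w = p @ s # us'" and "us' @ w = x @ s # q" by auto
      then consider vs where "us' = x @ vs" "vs @ w = s # q"
        | vs where "us' @ vs = x" "w = vs @ s # q"
        by (auto simp: append_eq_append_conv2)
      then show ?thesis
      proof cases
        case vs: 1
        show ?thesis
        proof (cases vs)
          case Nil
          then show ?thesis using vs w across[of p us' "[]" q] by simp
        next
          case (Cons r ys)
          then show ?thesis using vs w inside[of p ys] by simp
        qed
      next
        case 2
        then show ?thesis using w across[of p us' vs q] by auto
      qed
    qed
  qed (use inside in blast)
qed

text \<open>Induction on the length of \<open>w\<close>. The hypothesis also admits the identity,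
  with \<open>A = {}\<close>, because a shortened word may become trivial. The bounds on
  \<open>g\<close> and \<open>A\<close> by \<open>set w\<close> ensure that a generator commuting
  with all letters of a shorter word also commutes with its conjugator and its product.\<close>

lemma involution_conjugate_independent:
  assumes "set w \<subseteq> {1..<n}"
    and "twin_elt n w \<otimes>\<^bsub>twin_group n\<^esub> twin_elt n w = \<one>\<^bsub>twin_group n\<^esub>"
  shows "\<exists>g A. set g \<subseteq> set w \<and> A \<subseteq> set w \<and> nonadjacent A \<and>
           twin_elt n g \<otimes>\<^bsub>twin_group n\<^esub> twin_elt n w \<otimes>\<^bsub>twin_group n\<^esub>
             inv\<^bsub>twin_group n\<^esub> twin_elt n g =
           twin_elt n (sorted_list_of_set A)"
  using assms
proof (induction w rule: length_induct)
  case (1 w)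
  interpret group "twin_group n" by (rule group_twin_group)
  let ?G = "twin_group n"
  let ?e = "twin_elt n"
  define conj_ind where "conj_ind w \<longleftrightarrow> (\<exists>g A. set g \<subseteq> set w \<and> A \<subseteq> set w \<and> nonadjacent A \<and>
    ?e g \<otimes>\<^bsub>?G\<^esub> ?e w \<otimes>\<^bsub>?G\<^esub> inv\<^bsub>?G\<^esub> ?e g = ?e (sorted_list_of_set A))" for w
  have IH: "conj_ind v"
    if "length v < length w" "set v \<subseteq> {1..<n}" "?e v \<otimes>\<^bsub>?G\<^esub> ?e v = \<one>\<^bsub>?G\<^esub>" for v
    using 1 that unfolding conj_ind_def by blast
  note w = \<open>set w \<subseteq> {1..<n}\<close>
  note sq = \<open>?e w \<otimes>\<^bsub>?G\<^esub> ?e w = \<one>\<^bsub>?G\<^esub>\<close>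
  \<comment> \<open>Here \<open>s x s = x\<close>, so two letters disappear without changing the
    element.\<close>
  have shorten: "conj_ind w"
    if "w = a @ s # x @ s # d" and x: "\<forall>t\<in>set x. \<not> adjacent s t" for a s x d
  proof -
    have in_gens: "s \<in> {1..<n}" "set a \<subseteq> {1..<n}" "set x \<subseteq> {1..<n}" "set d \<subseteq> {1..<n}"
      using w that(1) by auto
    let ?s = "?e [s]"
    have [simp]: "?s \<in> carrier ?G" "?e a \<in> carrier ?G" "?e x \<in> carrier ?G" "?e d \<in> carrier ?G"
      using in_gens by auto
    have "?e w = ?e a \<otimes>\<^bsub>?G\<^esub> ((?s \<otimes>\<^bsub>?G\<^esub> ?e x) \<otimes>\<^bsub>?G\<^esub> (?s \<otimes>\<^bsub>?G\<^esub> ?e d))"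
      using in_gens unfolding that(1)
      by (simp add: twin_elt_append twin_elt_Cons[of s n "x @ s # d"] twin_elt_Cons[of s n d] m_assoc)
    also have "\<dots> = ?e a \<otimes>\<^bsub>?G\<^esub> (?e x \<otimes>\<^bsub>?G\<^esub> ((?s \<otimes>\<^bsub>?G\<^esub> ?s) \<otimes>\<^bsub>?G\<^esub> ?e d))"
      using in_gens x by (subst twin_elt_commute) (auto simp: m_assoc)
    also have "\<dots> = ?e (a @ x @ d)"
      using in_gens by (simp add: twin_elt_append twin_elt_square)
    finally have eq: "?e w = ?e (a @ x @ d)" .
    have "conj_ind (a @ x @ d)"
      using in_gens sq eq by (intro IH) (auto simp: that(1))
    then obtain g A where "set g \<subseteq> set (a @ x @ d)" "A \<subseteq> set (a @ x @ d)" "nonadjacent A"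
      "?e g \<otimes>\<^bsub>?G\<^esub> ?e w \<otimes>\<^bsub>?G\<^esub> inv\<^bsub>?G\<^esub> ?e g = ?e (sorted_list_of_set A)"
      unfolding conj_ind_def eq by blast
    moreover have "set (a @ x @ d) \<subseteq> set w" by (auto simp: that(1))
    ultimately show ?thesis unfolding conj_ind_def by (meson subset_trans)
  qed
  \<comment> \<open>The two letters \<open>s\<close> can be moved to the two ends of
    \<open>w\<close>, so conjugation by \<open>s\<close> removes both.\<close>
  have conjugate: "conj_ind w"
    if "w = c @ s # y @ s # b" and cb: "\<forall>t\<in>set c \<union> set b. \<not> adjacent s t" for c s y b
  proof -
    have in_gens: "s \<in> {1..<n}" "set c \<subseteq> {1..<n}" "set y \<subseteq> {1..<n}" "set b \<subseteq> {1..<n}"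
      using w that(1) by auto
    let ?s = "?e [s]"
    have [simp]: "?s \<in> carrier ?G" "?e c \<in> carrier ?G" "?e y \<in> carrier ?G" "?e b \<in> carrier ?G"
      "?e w \<in> carrier ?G"
      using in_gens w by auto
    have ss: "?s \<otimes>\<^bsub>?G\<^esub> ?s = \<one>\<^bsub>?G\<^esub>" using in_gens by (simp add: twin_elt_square)
    have cancel: "?s \<otimes>\<^bsub>?G\<^esub> (?s \<otimes>\<^bsub>?G\<^esub> z) = z" if "z \<in> carrier ?G" for z
      using that by (simp add: m_assoc[symmetric] ss)
    have inv_s: "inv\<^bsub>?G\<^esub> ?s = ?s" using ss by (intro inv_equality) auto
    have "?s \<otimes>\<^bsub>?G\<^esub> ?e w \<otimes>\<^bsub>?G\<^esub> ?s =
        (?s \<otimes>\<^bsub>?G\<^esub> ?e c) \<otimes>\<^bsub>?G\<^esub> (?s \<otimes>\<^bsub>?G\<^esub> (?e y \<otimes>\<^bsub>?G\<^esub> (?s \<otimes>\<^bsub>?G\<^esub> (?e b \<otimes>\<^bsub>?G\<^esub> ?s))))"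
      using in_gens unfolding that(1)
      by (simp add: twin_elt_append twin_elt_Cons[of s n "y @ s # b"] twin_elt_Cons[of s n b] m_assoc)
    also have "\<dots> = (?e c \<otimes>\<^bsub>?G\<^esub> ?s) \<otimes>\<^bsub>?G\<^esub> (?s \<otimes>\<^bsub>?G\<^esub> (?e y \<otimes>\<^bsub>?G\<^esub> (?s \<otimes>\<^bsub>?G\<^esub> (?s \<otimes>\<^bsub>?G\<^esub> ?e b))))"
      using in_gens cb twin_elt_commute[of s n c] twin_elt_commute[of s n b] by auto
    also have "\<dots> = ?e (c @ y @ b)"
      using in_gens by (simp add: twin_elt_append m_assoc cancel)
    finally have eq: "?s \<otimes>\<^bsub>?G\<^esub> ?e w \<otimes>\<^bsub>?G\<^esub> ?s = ?e (c @ y @ b)" .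
    have "?e (c @ y @ b) \<otimes>\<^bsub>?G\<^esub> ?e (c @ y @ b) = ?s \<otimes>\<^bsub>?G\<^esub> (?e w \<otimes>\<^bsub>?G\<^esub> ?e w) \<otimes>\<^bsub>?G\<^esub> ?s"
      unfolding eq[symmetric] by (simp add: m_assoc cancel)
    also have "\<dots> = \<one>\<^bsub>?G\<^esub>" by (simp add: sq ss)
    finally have "conj_ind (c @ y @ b)"
      using in_gens by (intro IH) (auto simp: that(1))
    then obtain g A where gA: "set g \<subseteq> set (c @ y @ b)" "A \<subseteq> set (c @ y @ b)" "nonadjacent A"
      "?e g \<otimes>\<^bsub>?G\<^esub> (?s \<otimes>\<^bsub>?G\<^esub> ?e w \<otimes>\<^bsub>?G\<^esub> ?s) \<otimes>\<^bsub>?G\<^esub> inv\<^bsub>?G\<^esub> ?e g = ?e (sorted_list_of_set A)"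
      unfolding conj_ind_def eq by blast
    have g: "set g \<subseteq> {1..<n}" using gA(1) in_gens by auto
    have "?e (g @ [s]) \<otimes>\<^bsub>?G\<^esub> ?e w \<otimes>\<^bsub>?G\<^esub> inv\<^bsub>?G\<^esub> ?e (g @ [s]) = ?e (sorted_list_of_set A)"
      unfolding gA(4)[symmetric] using g in_gens
      by (simp add: twin_elt_append inv_mult_group inv_s m_assoc)
    moreover have "set (g @ [s]) \<subseteq> set w" "A \<subseteq> set w" using gA by (auto simp: that(1))
    ultimately show ?thesis using gA(3) unfolding conj_ind_def by blast
  qed
  \<comment> \<open>Here \<open>s\<close> commutes with every other letter. If it occurs again,
    \<open>shorten\<close> applies. Otherwise \<open>w\<close> equals \<open>s\<close> times the
    remaining word, which squares to 1 too and whose conjugator fixes \<open>s\<close>.\<close>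
  have split_off: "conj_ind w"
    if "w = c @ s # b" and cb: "\<forall>t\<in>set c \<union> set b. \<not> adjacent s t" for c s b
  proof (cases "s \<in> set c \<union> set b")
    case True
    then consider c1 c2 where "c = c1 @ s # c2" | b1 b2 where "b = b1 @ s # b2"
      by (auto dest: split_list)
    then show ?thesis
    proof cases
      case 1
      then show ?thesis using that by (intro shorten[of c1 s c2 b]) auto
    next
      case 2
      then show ?thesis using that by (intro shorten[of c s b1 b2]) auto
    qed
  next
    case False
    have in_gens: "s \<in> {1..<n}" "set c \<subseteq> {1..<n}" "set b \<subseteq> {1..<n}"
      using w that(1) by auto
    let ?s = "?e [s]"
    let ?v = "c @ b"
    have [simp]: "?s \<in> carrier ?G" "?e c \<in> carrier ?G" "?e b \<in> carrier ?G" "?e ?v \<in> carrier ?G"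
      using in_gens by auto
    have ss: "?s \<otimes>\<^bsub>?G\<^esub> ?s = \<one>\<^bsub>?G\<^esub>" using in_gens by (simp add: twin_elt_square)
    have comm: "?s \<otimes>\<^bsub>?G\<^esub> ?e v = ?e v \<otimes>\<^bsub>?G\<^esub> ?s" if "set v \<subseteq> set ?v" for v
      using that in_gens cb by (intro twin_elt_commute) auto
    have "?e w = ?e c \<otimes>\<^bsub>?G\<^esub> ?s \<otimes>\<^bsub>?G\<^esub> ?e b"
      using in_gens unfolding that(1)
      by (simp add: twin_elt_append twin_elt_Cons[of s n b] m_assoc)
    also have "\<dots> = ?s \<otimes>\<^bsub>?G\<^esub> ?e ?v"
      using in_gens comm[of c] by (simp add: twin_elt_append m_assoc[symmetric])
    finally have eq: "?e w = ?s \<otimes>\<^bsub>?G\<^esub> ?e ?v" .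
    have "\<one>\<^bsub>?G\<^esub> = (?s \<otimes>\<^bsub>?G\<^esub> ?e ?v) \<otimes>\<^bsub>?G\<^esub> (?s \<otimes>\<^bsub>?G\<^esub> ?e ?v)" using sq eq by simp
    also have "\<dots> = ?s \<otimes>\<^bsub>?G\<^esub> (?e ?v \<otimes>\<^bsub>?G\<^esub> ?s) \<otimes>\<^bsub>?G\<^esub> ?e ?v" by (simp add: m_assoc)
    also have "\<dots> = (?s \<otimes>\<^bsub>?G\<^esub> ?s) \<otimes>\<^bsub>?G\<^esub> (?e ?v \<otimes>\<^bsub>?G\<^esub> ?e ?v)"
      unfolding comm[of ?v, OF subset_refl, symmetric] by (simp add: m_assoc)
    finally have "?e ?v \<otimes>\<^bsub>?G\<^esub> ?e ?v = \<one>\<^bsub>?G\<^esub>" by (simp add: ss)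
    then have "conj_ind ?v"
      using in_gens by (intro IH) (auto simp: that(1))
    then obtain g A where gA: "set g \<subseteq> set ?v" "A \<subseteq> set ?v" "nonadjacent A"
      "?e g \<otimes>\<^bsub>?G\<^esub> ?e ?v \<otimes>\<^bsub>?G\<^esub> inv\<^bsub>?G\<^esub> ?e g = ?e (sorted_list_of_set A)"
      unfolding conj_ind_def by blast
    have g [simp]: "?e g \<in> carrier ?G" using gA(1) in_gens by (intro twin_elt_carrier) auto
    have fin: "finite A" using gA(2) finite_subset by blast
    have "?e g \<otimes>\<^bsub>?G\<^esub> ?e w \<otimes>\<^bsub>?G\<^esub> inv\<^bsub>?G\<^esub> ?e g =
        (?e g \<otimes>\<^bsub>?G\<^esub> ?s) \<otimes>\<^bsub>?G\<^esub> ?e ?v \<otimes>\<^bsub>?G\<^esub> inv\<^bsub>?G\<^esub> ?e g"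
      unfolding eq by (simp add: m_assoc)
    also have "\<dots> = ?s \<otimes>\<^bsub>?G\<^esub> (?e g \<otimes>\<^bsub>?G\<^esub> ?e ?v \<otimes>\<^bsub>?G\<^esub> inv\<^bsub>?G\<^esub> ?e g)"
      unfolding comm[OF gA(1), symmetric] by (simp add: m_assoc)
    also have "\<dots> = ?e (insort s (sorted_list_of_set A))"
      unfolding gA(4) using gA(2) in_gens cb fin by (intro twin_elt_insort[symmetric]) auto
    also have "\<dots> = ?e (sorted_list_of_set (insert s A))"
      using fin gA(2) False by (subst sorted_list_of_set_insert) auto
    finally have "?e g \<otimes>\<^bsub>?G\<^esub> ?e w \<otimes>\<^bsub>?G\<^esub> inv\<^bsub>?G\<^esub> ?e g = ?e (sorted_list_of_set (insert s A))" .
    moreover have "nonadjacent (insert s A)"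
      using gA(2,3) cb adjacent_commute unfolding nonadjacent_def by auto
    moreover have "set g \<subseteq> set w" "insert s A \<subseteq> set w" using gA by (auto simp: that(1))
    ultimately show ?thesis unfolding conj_ind_def by blast
  qed
  have "conj_ind w"
  proof (cases "w = []")
    case True
    then show ?thesis
      unfolding conj_ind_def
      by (intro exI[of _ "[]"] exI[of _ "{}"]) (auto simp: nonadjacent_def twin_elt_Nil)
  next
    case False
    have "\<not> reduced (w @ w)"
      using reduced_trivial[of n "w @ w"] False w sq by (auto simp: twin_elt_append)
    then obtain p s x q where "w @ w = p @ s # x @ s # q" and x: "\<forall>t\<in>set x. \<not> adjacent s t"
      using not_reduced_split by blast
    then show ?thesis
    proof (cases rule: square_split)
      case (inside a d)
      then show ?thesis using x by (rule shorten)
    next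
      case (across p' b c q')
      then have bc: "\<forall>t\<in>set c \<union> set b. \<not> adjacent s t" using x by auto
      \<comment> \<open>Compare the positions of the two letters inside the single word
        \<open>w\<close>. They coincide (\<open>split_off\<close>), or the one after
        \<open>c\<close> is the earlier (\<open>conjugate\<close>), or the later; then the letters
        between them belong to \<open>c\<close> and commute with \<open>s\<close>
        (\<open>shorten\<close>).\<close>
      from across(1,2) have "p' @ s # b = c @ s # q'" by simp
      then consider "p' = c" "b = q'" | y where "p' = c @ s # y" | y where "c = p' @ s # y"
        by (auto simp: append_eq_append_conv2 Cons_eq_append_conv append_eq_Cons_conv)
      then show ?thesis
      proof cases
        case 1
        then show ?thesis using across(1) bc by (intro split_off[of c s b]) auto
      next
        case 2
        then show ?thesis using across(1) bc by (intro conjugate[of c s y b]) auto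
      next
        case 3
        then show ?thesis using across(2) bc by (intro shorten[of p' s y q']) auto
      qed
    qed
  qed
  then show ?case unfolding conj_ind_def .
qed

section \<open>Products over independent sets: squares and non-conjugacy\<close>

lemma independent_square:
  assumes "finite A" "A \<subseteq> {1..<n}" "nonadjacent A"
  shows "twin_elt n (sorted_list_of_set A) \<otimes>\<^bsub>twin_group n\<^esub> twin_elt n (sorted_list_of_set A) =
         \<one>\<^bsub>twin_group n\<^esub>"
  using assms
proof (induction A)
  interpret group "twin_group n" by (rule group_twin_group)
  {
    case empty
    show ?case by (simp add: twin_elt_Nil)
  next
    case (insert s A)
    let ?G = "twin_group n"
    let ?s = "twin_elt n [s]"
    let ?a = "twin_elt n (sorted_list_of_set A)"
    have [simp]: "?s \<in> carrier ?G" "?a \<in> carrier ?G" using insert by auto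
    have far: "\<forall>t\<in>set (sorted_list_of_set A). \<not> adjacent s t"
      using insert by (auto simp: nonadjacent_def)
    have comm: "?s \<otimes>\<^bsub>?G\<^esub> ?a = ?a \<otimes>\<^bsub>?G\<^esub> ?s"
      using insert far by (intro twin_elt_commute) auto
    have "twin_elt n (sorted_list_of_set (insert s A)) = ?s \<otimes>\<^bsub>?G\<^esub> ?a"
      using insert far by (simp add: twin_elt_insort)
    moreover have "(?s \<otimes>\<^bsub>?G\<^esub> ?a) \<otimes>\<^bsub>?G\<^esub> (?s \<otimes>\<^bsub>?G\<^esub> ?a) = ?s \<otimes>\<^bsub>?G\<^esub> (?a \<otimes>\<^bsub>?G\<^esub> ?s) \<otimes>\<^bsub>?G\<^esub> ?a"
      by (simp add: m_assoc)
    moreover have "\<dots> = (?s \<otimes>\<^bsub>?G\<^esub> ?s) \<otimes>\<^bsub>?G\<^esub> (?a \<otimes>\<^bsub>?G\<^esub> ?a)"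
      unfolding comm[symmetric] by (simp add: m_assoc)
    ultimately show ?case
      using insert by (simp add: twin_elt_square nonadjacent_def)
  }
qed

lemma count_list_sorted_list_of_set:
  assumes "finite A"
  shows "odd (count_list (sorted_list_of_set A) a) \<longleftrightarrow> a \<in> A"
proof -
  have "distinct xs \<Longrightarrow> count_list xs a = of_bool (a \<in> set xs)" for xs
    by (induction xs) auto
  thus ?thesis using assms by simp
qed

text \<open>Conjugation by \<open>u\<close> adds the letters of \<open>u\<close> and of
  \<open>rev u\<close>, an even number of each, so the parities of the letters recover the
  set.\<close>

lemma independent_conjugate_eq:
  assumes "A \<subseteq> {1..<n}" "B \<subseteq> {1..<n}" "g \<in> carrier (twin_group n)"
    and "twin_elt n (sorted_list_of_set A) =
         g \<otimes>\<^bsub>twin_group n\<^esub> twin_elt n (sorted_list_of_set B) \<otimes>\<^bsub>twin_group n\<^esub>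
           inv\<^bsub>twin_group n\<^esub> g"
  shows "A = B"
proof -
  have fin: "finite A" "finite B" using assms(1,2) by (auto intro: finite_subset)
  obtain u where u: "set u \<subseteq> {1..<n}" "g = twin_elt n u"
    using assms(3) by (rule twin_group_elt_cases)
  interpret group "twin_group n" by (rule group_twin_group)
  have "twin_elt n (u @ sorted_list_of_set B @ rev u) = twin_elt n (sorted_list_of_set A)"
    using assms(2) u fin unfolding assms(4)
    by (simp add: twin_elt_append twin_elt_rev m_assoc)
  from twin_elt_parity[OF this] have "a \<in> A \<longleftrightarrow> a \<in> B" for a
    using fin assms(1) count_list_sorted_list_of_set[of A a] count_list_sorted_list_of_set[of B a]
    by auto
  thus ?thesis by blast
qed

section \<open>Involutions and conjugacy classes in a general group\<close>

lemma (in group) mem_involutions_iff: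
  "x \<in> involutions G \<longleftrightarrow> x \<in> carrier G \<and> x \<noteq> \<one> \<and> x \<otimes> x = \<one>"
proof (cases "x \<in> carrier G")
  case True
  \<comment> \<open>Elements of infinite order have \<open>ord x = 0\<close>, which does not divide
    2.\<close>
  have "ord x = 2 \<longleftrightarrow> ord x dvd 2 \<and> ord x \<noteq> 1"
    using two_is_prime_nat by (auto simp: prime_nat_iff)
  also have "\<dots> \<longleftrightarrow> x \<otimes> x = \<one> \<and> x \<noteq> \<one>"
    using True pow_eq_id[of x 2] ord_eq_1[of x] by (simp add: numeral_2_eq_2)
  finally show ?thesis using True by (auto simp: involutions_def)
qed (simp add: involutions_def)

lemma (in group) conjugacy_class_conjugate:
  assumes "g \<in> carrier G" "x \<in> carrier G"
  shows "conjugacy_class G (g \<otimes> x \<otimes> inv g) = conjugacy_class G x"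
proof (intro equalityI subsetI)
  fix y assume "y \<in> conjugacy_class G (g \<otimes> x \<otimes> inv g)"
  then obtain h where h: "h \<in> carrier G" "y = h \<otimes> (g \<otimes> x \<otimes> inv g) \<otimes> inv h"
    by (auto simp: conjugacy_class_def)
  hence "y = (h \<otimes> g) \<otimes> x \<otimes> inv (h \<otimes> g)"
    using assms by (simp add: m_assoc inv_mult_group)
  thus "y \<in> conjugacy_class G x" using h assms unfolding conjugacy_class_def by blast
next
  fix y assume "y \<in> conjugacy_class G x"
  then obtain h where h: "h \<in> carrier G" "y = h \<otimes> x \<otimes> inv h"
    by (auto simp: conjugacy_class_def)
  hence "y = (h \<otimes> inv g) \<otimes> (g \<otimes> x \<otimes> inv g) \<otimes> inv (h \<otimes> inv g)"
    using assms by (simp add: m_assoc inv_mult_group) (simp add: m_assoc[symmetric])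
  thus "y \<in> conjugacy_class G (g \<otimes> x \<otimes> inv g)"
    using h assms unfolding conjugacy_class_def by blast
qed

lemma (in group) mem_conjugacy_class_self: "x \<in> carrier G \<Longrightarrow> x \<in> conjugacy_class G x"
  unfolding conjugacy_class_def by (auto intro!: exI[of _ \<one>])

section \<open>Counting independent sets of a path\<close>

text \<open>The empty set is included; it stands for the identity and accounts for the 1 in
  \<open>rho n + 1\<close>.\<close>

definition independent_sets :: "nat \<Rightarrow> nat set set" where
  "independent_sets n = {A. A \<subseteq> {1..<n} \<and> nonadjacent A}"

lemma finite_independent_sets: "finite (independent_sets n)"
  by (rule finite_subset[of _ "Pow {1..<n}"]) (auto simp: independent_sets_def)

text \<open>A set containing the last generator \<open>Suc n\<close> must omit \<open>n\<close>, so
  the rest of it lies in \<open>{1..<n}\<close>. This gives the Fibonacci recursion.\<close>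

lemma independent_sets_Suc_Suc:
  "independent_sets (Suc (Suc n)) =
     independent_sets (Suc n) \<union> insert (Suc n) ` independent_sets n"
proof (intro equalityI subsetI)
  fix A assume A: "A \<in> independent_sets (Suc (Suc n))"
  show "A \<in> independent_sets (Suc n) \<union> insert (Suc n) ` independent_sets n"
  proof (cases "Suc n \<in> A")
    case True
    have "i < n" if "i \<in> A - {Suc n}" for i
    proof -
      have "i \<noteq> n" using A True that by (auto simp: independent_sets_def nonadjacent_def adjacent_def)
      moreover have "i < Suc (Suc n)" using A that by (auto simp: independent_sets_def)
      ultimately show ?thesis using that by simp
    qed
    moreover have "1 \<le> i" if "i \<in> A" for i
      using A that by (auto simp: independent_sets_def)
    ultimately have "A - {Suc n} \<subseteq> {1..<n}" by (meson DiffD1 atLeastLessThan_iff subsetI)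
    hence "A - {Suc n} \<in> independent_sets n"
      using A by (auto simp: independent_sets_def nonadjacent_def)
    moreover have "A = insert (Suc n) (A - {Suc n})" using True by blast
    ultimately show ?thesis by blast
  next
    case False
    with A show ?thesis
      by (auto simp: independent_sets_def) (metis less_SucE atLeastLessThan_iff subsetD)+
  qed
next
  fix A assume "A \<in> independent_sets (Suc n) \<union> insert (Suc n) ` independent_sets n"
  thus "A \<in> independent_sets (Suc (Suc n))"
    by (fastforce simp: independent_sets_def nonadjacent_def adjacent_def)
qed

lemma card_independent_sets: "card (independent_sets n) = fib (n + 1)"
proof (induction n rule: fib.induct)
  case 1
  have "independent_sets 0 = {{}}" by (auto simp: independent_sets_def nonadjacent_def)
  thus ?case by simp
next
  case 2
  have "independent_sets (Suc 0) = {{}}" by (auto simp: independent_sets_def nonadjacent_def)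
  thus ?case by simp
next
  case (3 n)
  have notin: "Suc n \<notin> A" if "A \<in> independent_sets n \<or> A \<in> independent_sets (Suc n)" for A
    using that by (auto simp: independent_sets_def)
  have "inj_on (insert (Suc n)) (independent_sets n)"
    using notin by (auto simp: inj_on_def) (metis insert_ident)+
  moreover have "independent_sets (Suc n) \<inter> insert (Suc n) ` independent_sets n = {}"
    using notin by blast
  ultimately show ?case
    using 3 by (simp add: independent_sets_Suc_Suc card_Un_disjoint finite_independent_sets
        card_image)
qed

section \<open>Classification and number of the classes\<close>

lemma conjugacy_classes_of_involutions:
  "conjugacy_class (twin_group n) ` involutions (twin_group n) =
   (\<lambda>A. conjugacy_class (twin_group n) (twin_elt n (sorted_list_of_set A))) `
     (independent_sets n - {{}})"
proof (intro equalityI subsetI)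
  interpret group "twin_group n" by (rule group_twin_group)
  let ?G = "twin_group n"
  fix C
  {
    assume "C \<in> conjugacy_class ?G ` involutions ?G"
    then obtain x where x: "C = conjugacy_class ?G x" "x \<in> carrier ?G" "x \<noteq> \<one>\<^bsub>?G\<^esub>"
      "x \<otimes>\<^bsub>?G\<^esub> x = \<one>\<^bsub>?G\<^esub>" by (auto simp: mem_involutions_iff)
    obtain w where w: "set w \<subseteq> {1..<n}" "x = twin_elt n w"
      using x(2) by (rule twin_group_elt_cases)
    obtain g A where gA: "set g \<subseteq> set w" "A \<subseteq> set w" "nonadjacent A"
      "twin_elt n g \<otimes>\<^bsub>?G\<^esub> x \<otimes>\<^bsub>?G\<^esub> inv\<^bsub>?G\<^esub> twin_elt n g = twin_elt n (sorted_list_of_set A)"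
      using involution_conjugate_independent[OF w(1)] x(4) unfolding w(2) by blast
    have g: "twin_elt n g \<in> carrier ?G" using gA(1) w(1) by (intro twin_elt_carrier) auto
    have "A \<noteq> {}"
    proof
      assume "A = {}"
      hence "twin_elt n g \<otimes>\<^bsub>?G\<^esub> x \<otimes>\<^bsub>?G\<^esub> inv\<^bsub>?G\<^esub> twin_elt n g = \<one>\<^bsub>?G\<^esub>"
        using gA(4) by (simp add: twin_elt_Nil)
      hence "twin_elt n g \<otimes>\<^bsub>?G\<^esub> x = twin_elt n g"
        using g x(2) by (metis inv_equality inv_inv inv_closed m_closed)
      thus False using g x(2,3) by simp
    qed
    moreover have "C = conjugacy_class ?G (twin_elt n (sorted_list_of_set A))"
      unfolding x(1) gA(4)[symmetric] using g x(2) by (rule conjugacy_class_conjugate[symmetric])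
    ultimately show "C \<in> (\<lambda>A. conjugacy_class ?G (twin_elt n (sorted_list_of_set A))) `
        (independent_sets n - {{}})"
      using gA(2,3) w(1) by (auto simp: independent_sets_def)
  next
    assume "C \<in> (\<lambda>A. conjugacy_class ?G (twin_elt n (sorted_list_of_set A))) `
        (independent_sets n - {{}})"
    then obtain A where A: "A \<subseteq> {1..<n}" "nonadjacent A" "A \<noteq> {}"
      "C = conjugacy_class ?G (twin_elt n (sorted_list_of_set A))"
      by (auto simp: independent_sets_def)
    have fin: "finite A" using A(1) by (auto intro: finite_subset)
    \<comment> \<open>The identity is the product over the empty set, so the parity invariant also
      shows that the product over a nonempty set is nontrivial.\<close>
    have "twin_elt n (sorted_list_of_set A) \<noteq> \<one>\<^bsub>?G\<^esub>"
      using independent_conjugate_eq[of A n "{}" "\<one>\<^bsub>?G\<^esub>"] A by (auto simp: twin_elt_Nil)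
    hence "twin_elt n (sorted_list_of_set A) \<in> involutions ?G"
      using A(1) fin independent_square[OF fin A(1,2)] by (simp add: mem_involutions_iff)
    thus "C \<in> conjugacy_class ?G ` involutions ?G" using A(4) by blast
  }
qed

lemma rho_eq_card: "rho n = card (independent_sets n - {{}})"
proof -
  interpret group "twin_group n" by (rule group_twin_group)
  have "inj_on (\<lambda>A. conjugacy_class (twin_group n) (twin_elt n (sorted_list_of_set A)))
      (independent_sets n - {{}})"
  proof (rule inj_onI)
    fix A B
    assume A: "A \<in> independent_sets n - {{}}" and B: "B \<in> independent_sets n - {{}}"
      and eq: "conjugacy_class (twin_group n) (twin_elt n (sorted_list_of_set A)) =
        conjugacy_class (twin_group n) (twin_elt n (sorted_list_of_set B))"
    have sub: "A \<subseteq> {1..<n}" "B \<subseteq> {1..<n}" using A B by (auto simp: independent_sets_def)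
    hence "finite A" by (auto intro: finite_subset)
    hence "twin_elt n (sorted_list_of_set A) \<in>
        conjugacy_class (twin_group n) (twin_elt n (sorted_list_of_set B))"
      using sub(1) unfolding eq[symmetric] by (intro mem_conjugacy_class_self) auto
    thus "A = B" using independent_conjugate_eq[OF sub] by (auto simp: conjugacy_class_def)
  qed
  thus ?thesis by (simp add: rho_def conjugacy_classes_of_involutions card_image)
qed

theorem corollary4p5:
  fixes n :: nat
  assumes "n \<ge> 2"
  shows "rho n + 1 = fib (n + 1) \<and> rho n = (\<Sum>k = 1..n div 2. (n - k) choose k)"
proof
  have "{} \<in> independent_sets n" by (simp add: independent_sets_def nonadjacent_def)
  hence "card (independent_sets n) = Suc (rho n)"
    unfolding rho_eq_card by (intro card.remove finite_independent_sets)
  thus fib: "rho n + 1 = fib (n + 1)" by (simp add: card_independent_sets)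
  \<comment> \<open>Fibonacci numbers are the sums along the shallow diagonals of Pascal's
    triangle.\<close>
  have "fib (Suc n) = (\<Sum>k = 0..n. (n - k) choose k)"
    by (rule ne_diagonal_fib[symmetric])
  \<comment> \<open>For \<open>k > n div 2\<close> one has \<open>n - k < k\<close>, so the binomial
    coefficient vanishes.\<close>
  also have "\<dots> = (\<Sum>k = 0..n div 2. (n - k) choose k)"
    by (rule sum.mono_neutral_right) (auto intro!: binomial_eq_0)
  also have "\<dots> = 1 + (\<Sum>k = 1..n div 2. (n - k) choose k)"
    by (simp add: sum.atLeast_Suc_atMost)
  finally show "rho n = (\<Sum>k = 1..n div 2. (n - k) choose k)" using fib by simp
qed

end
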